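(* Let $k \ge 2$ be an integer and let $\mathbb{V}$ be a finite universe of values with $|\mathbb{V}| \ge k+1$. Then complete $k$-set agreement, i.e. the SOS problem $\Pi_O$ with $O=\{o\subseteq\mathbb{V} : 1\le |o|\le k\}$, is solvable asynchronously under any number of crashes $f$.
   Context: Computing model. A system consists of a nonempty finite set $P=\{p_1,\dots,p_n\}$ of $n$ processes. Processes are deterministic and take steps according to their local state and the events they observe, following an algorithm $A$. In an execution, a process may crash (halt prematurely and take no further step) but does not otherwise deviate from its algorithm; at most $f$ processes may crash in an execution, with $0 \le f \le n$. A process that does not crash in an execution is correct in it. Each process has a private local clock, running at its own arbitrary pace, usable to set local timeouts. Processes interact through two operations: "communicate $I$" (disseminate information $I$ to all processes) and the callback "observe $I$" (be notified that $I$ was communicated), satisfying: (C-Validity) if a process observes $I$, then $I$ was previously communicated by some process; (C-Integrity) a process observes information $I$ communicated by a given process at most once; (C-Local-Termination) if a correct process communicates $I$, then some correct process (if there is any) eventually observes $I$; (C-Global-Termination) if a correct process observes $I$, then all correct processes eventually observe $I$. The system is asynchronous: there is no bound on communication delays, and any ordering or timing of observations consistent with these properties can occur. Tasks. $\mathbb{V}$ is a finite universe of values and $\bot \notin \mathbb{V}$ denotes no input or no output. For a system of size $n$, an input vector $V_{\rm in}$ and an output vector $V_{\rm out}$ are elements of $(\mathbb{V}\cup\{\bot\})^n$, whose $i$-th entries are the input and output values of process $p_i$. A process outputs at most one value in an execution. A task is a triple $T=(\mathcal{I},\mathcal{O},\Delta)$, where $\mathcal I,\mathcal O$ are sets of input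 and output vectors and $\Delta\subseteq\mathcal I\times\mathcal O$ is a nonempty relation whose pairs consist of vectors of the same size (different pairs may have different sizes). $T_n=(\mathcal I_n,\mathcal O_n,\Delta_n)$ is the restriction of $T$ to vectors of size $n$. A task problem is a set of tasks. An algorithm $A$ implements $T$ if $T=(\mathcal I_A,\mathcal O_A,\Delta_A)$, where $\mathcal I_A,\mathcal O_A$ are the sets of input/output vectors admitted by $A$ and $\Delta_A$ is the set of pairs $(V_{\rm in},V_{\rm out})$ it produces across all its executions. $A$ supports a size $n$ if it admits executions with $n$ processes. A task problem is solvable under asynchrony and up to $f$ crashes if at least one of its tasks is implemented by some asynchronous algorithm tolerating up to $f$ crashes. SOS problems. The output set of an output vector is $\mathit{OS}(V_{\rm out})=\{v : v \text{ is an entry of } V_{\rm out},\ v\neq\bot\}$. For a task $T$, $\mathit{SOS}(T)=\{\mathit{OS}(V_{\rm out}) : (V_{\rm in},V_{\rm out})\in\Delta\}$. For nonempty $O\subseteq 2^{\mathbb V}$, the SOS problem $\Pi_O$ is the set of all (nonempty) tasks $T$ such that for every $n$ with $T_n\neq\varnothing$: (i) $\mathit{SOS}(T_n)=O$, and (ii) $\Delta_n=\mathcal I_n\times\mathcal O_n$. Thus solving $\Pi_O$ amounts to giving an algorithm $A$ that, besides satisfying (ii) (for which it suffices to ignore inputs), satisfies: (Safety) every execution of $A$ produces an output vector $V_{\rm out}$ with $\mathit{OS}(V_{\rm out})\in O$; (Completeness) for every size $n$ supported by $A$ and every $o\in O$, some execution of $A$ produces an output vector of size $n$ with output set $o$.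 *)

theory Defs
  imports Main
begin

section \<open>Vectors and tasks\<close>

text \<open>
  A vector of size \<open>n\<close> is a list of length \<open>n\<close>; \<open>None\<close> plays the role of bottom
  (no input, no output). Systems are nonempty, so the empty list is excluded.
\<close>

definition vectors :: "'v set \<Rightarrow> 'v option list set" where
  "vectors V = {xs. xs \<noteq> [] \<and> set xs \<subseteq> insert None (Some ` V)}"

record 'v task =
  task_in :: "'v option list set"
  task_out :: "'v option list set"
  task_rel :: "('v option list \<times> 'v option list) set"

definition is_task :: "'v set \<Rightarrow> 'v task \<Rightarrow> bool" where
  "is_task V T \<longleftrightarrow>
     task_in T \<subseteq> vectors V \<and> task_out T \<subseteq> vectors V \<and>
     task_rel T \<subseteq> task_in T \<times> task_out T \<and> task_rel T \<noteq> {} \<and>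
     (\<forall>(vin, vout) \<in> task_rel T. length vin = length vout)"

definition restrict_task :: "nat \<Rightarrow> 'v task \<Rightarrow> 'v task" where
  "restrict_task n T =
     \<lparr>task_in = {vin \<in> task_in T. length vin = n},
      task_out = {vout \<in> task_out T. length vout = n},
      task_rel = {(vin, vout) \<in> task_rel T. length vin = n \<and> length vout = n}\<rparr>"

definition output_set :: "'v option list \<Rightarrow> 'v set" where
  "output_set vout = {v. Some v \<in> set vout}"

definition SOS :: "'v task \<Rightarrow> 'v set set" where
  "SOS T = {output_set vout | vin vout. (vin, vout) \<in> task_rel T}"

text \<open>
  As a task is nonempty when its relation is, the restriction to size \<open>n\<close> counts as
  nonempty when its relation is nonempty.
\<close>

definition SOS_problem :: "'v set \<Rightarrow> 'v set set \<Rightarrow> 'v task set" where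
  "SOS_problem V Os =
     {T. is_task V T \<and>
         (\<forall>n. task_rel (restrict_task n T) \<noteq> {} \<longrightarrow>
            SOS (restrict_task n T) = Os \<and>
            task_rel (restrict_task n T) =
              task_in (restrict_task n T) \<times> task_out (restrict_task n T))}"


section \<open>Algorithms and their asynchronous executions\<close>

datatype ('m, 'v) action = Skip | Communicate 'm | Output 'v

text \<open>
  The processes of a system of size \<open>n\<close> are \<open>0, \<dots>, n - 1\<close>. Each runs a deterministic
  automaton whose initial state may depend on \<open>n\<close>, on its index and on its input entry.
  A local step is a tick of the private clock and performs at most one action, so a crash
  may fall between any two actions; timeouts amount to counting local steps. The callback
  \<open>on_observe\<close> only receives the information itself, not its origin.
\<close>

record ('s, 'm, 'v) algorithm =
  admitted :: "'v option list set"
  init :: "nat \<Rightarrow> nat \<Rightarrow> 'v option \<Rightarrow> 's"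
  local_step :: "'s \<Rightarrow> 's \<times> ('m, 'v) action"
  on_observe :: "'m \<Rightarrow> 's \<Rightarrow> 's"

text \<open>
  \<open>Observe p q m\<close>: process \<open>p\<close> observes the information \<open>m\<close> communicated by \<open>q\<close>.
  \<open>Idle\<close> lets an infinite execution continue when every process has crashed.
\<close>

datatype 'm event = Step nat | Observe nat nat 'm | Crash nat | Idle

fun process_of :: "'m event \<Rightarrow> nat option" where
  "process_of (Step p) = Some p"
| "process_of (Observe p q m) = Some p"
| "process_of (Crash p) = Some p"
| "process_of Idle = None"

primrec local_states ::
  "('s, 'm, 'v) algorithm \<Rightarrow> 'v option list \<Rightarrow> (nat \<Rightarrow> 'm event) \<Rightarrow> nat \<Rightarrow> nat \<Rightarrow> 's"
where
  "local_states A vin \<sigma> 0 = (\<lambda>p. init A (length vin) p (vin ! p))"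
| "local_states A vin \<sigma> (Suc t) =
     (let s = local_states A vin \<sigma> t in
      case \<sigma> t of
        Step p \<Rightarrow> s(p := fst (local_step A (s p)))
      | Observe p q m \<Rightarrow> s(p := on_observe A m (s p))
      | Crash p \<Rightarrow> s
      | Idle \<Rightarrow> s)"

definition performs ::
  "('s, 'm, 'v) algorithm \<Rightarrow> 'v option list \<Rightarrow> (nat \<Rightarrow> 'm event) \<Rightarrow> nat \<Rightarrow> nat \<Rightarrow> ('m, 'v) action \<Rightarrow> bool"
where
  "performs A vin \<sigma> t p a \<longleftrightarrow>
     \<sigma> t = Step p \<and> snd (local_step A (local_states A vin \<sigma> t p)) = a"

definition crashed :: "nat \<Rightarrow> (nat \<Rightarrow> 'm event) \<Rightarrow> nat set" where
  "crashed n \<sigma> = {p. p < n \<and> (\<exists>t. \<sigma> t = Crash p)}"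

definition correct :: "nat \<Rightarrow> (nat \<Rightarrow> 'm event) \<Rightarrow> nat set" where
  "correct n \<sigma> = {p. p < n} - crashed n \<sigma>"

definition C_validity where
  "C_validity A vin \<sigma> \<longleftrightarrow>
     (\<forall>t p q m. \<sigma> t = Observe p q m \<longrightarrow> (\<exists>t' < t. performs A vin \<sigma> t' q (Communicate m)))"

definition C_integrity :: "(nat \<Rightarrow> 'm event) \<Rightarrow> bool" where
  "C_integrity \<sigma> \<longleftrightarrow>
     (\<forall>t t' p q m. \<sigma> t = Observe p q m \<and> \<sigma> t' = Observe p q m \<longrightarrow> t = t')"

text \<open>
  The observation required below is the one that originates from \<open>q\<close>, so by validity it
  follows a communication of \<open>m\<close> by \<open>q\<close>. It need not follow every such communication:
  if \<open>q\<close> communicates \<open>m\<close> twice, integrity forbids a second observation.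
\<close>

definition C_local_termination where
  "C_local_termination A vin \<sigma> \<longleftrightarrow>
     (\<forall>t q m. q \<in> correct (length vin) \<sigma> \<and> performs A vin \<sigma> t q (Communicate m) \<longrightarrow>
        (\<exists>p \<in> correct (length vin) \<sigma>. \<exists>t'. \<sigma> t' = Observe p q m))"

definition C_global_termination :: "nat \<Rightarrow> (nat \<Rightarrow> 'm event) \<Rightarrow> bool" where
  "C_global_termination n \<sigma> \<longleftrightarrow>
     (\<forall>t p q m. p \<in> correct n \<sigma> \<and> \<sigma> t = Observe p q m \<longrightarrow>
        (\<forall>p' \<in> correct n \<sigma>. \<exists>t'. \<sigma> t' = Observe p' q m))"

text \<open>
  Executions are complete: a correct process takes infinitely many local steps, at a pace
  that is otherwise unconstrained.
\<close>

definition execution ::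
  "nat \<Rightarrow> ('s, 'm, 'v) algorithm \<Rightarrow> 'v option list \<Rightarrow> (nat \<Rightarrow> 'm event) \<Rightarrow> bool"
where
  "execution f A vin \<sigma> \<longleftrightarrow>
     vin \<in> admitted A \<and>
     (\<forall>t p. process_of (\<sigma> t) = Some p \<longrightarrow> p < length vin) \<and>
     (\<forall>t t' p. \<sigma> t = Crash p \<and> t < t' \<longrightarrow> process_of (\<sigma> t') \<noteq> Some p) \<and>
     card (crashed (length vin) \<sigma>) \<le> f \<and>
     (\<forall>p \<in> correct (length vin) \<sigma>. infinite {t. \<sigma> t = Step p}) \<and>
     C_validity A vin \<sigma> \<and> C_integrity \<sigma> \<and>
     C_local_termination A vin \<sigma> \<and> C_global_termination (length vin) \<sigma>"

text \<open>
  Admitted algorithms: the crash bound does not exceed the size of any supported system,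
  and no process outputs twice.
\<close>

definition valid_algorithm :: "nat \<Rightarrow> ('s, 'm, 'v) algorithm \<Rightarrow> bool" where
  "valid_algorithm f A \<longleftrightarrow>
     (\<forall>vin \<in> admitted A. vin \<noteq> [] \<and> f \<le> length vin) \<and>
     (\<forall>vin \<sigma> t t' p v v'.
        execution f A vin \<sigma> \<and> performs A vin \<sigma> t p (Output v) \<and>
        performs A vin \<sigma> t' p (Output v') \<longrightarrow> t = t')"

definition output_vector ::
  "('s, 'm, 'v) algorithm \<Rightarrow> 'v option list \<Rightarrow> (nat \<Rightarrow> 'm event) \<Rightarrow> 'v option list"
where
  "output_vector A vin \<sigma> =
     map (\<lambda>p. if \<exists>t v. performs A vin \<sigma> t p (Output v)
              then Some (THE v. \<exists>t. performs A vin \<sigma> t p (Output v)) else None)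
       [0..<length vin]"

definition algorithm_task :: "nat \<Rightarrow> ('s, 'm, 'v) algorithm \<Rightarrow> 'v task" where
  "algorithm_task f A =
     \<lparr>task_in = admitted A,
      task_out = {output_vector A vin \<sigma> | vin \<sigma>. execution f A vin \<sigma>},
      task_rel = {(vin, output_vector A vin \<sigma>) | vin \<sigma>. execution f A vin \<sigma>}\<rparr>"

definition implements :: "nat \<Rightarrow> ('s, 'm, 'v) algorithm \<Rightarrow> 'v task \<Rightarrow> bool" where
  "implements f A T \<longleftrightarrow> valid_algorithm f A \<and> T = algorithm_task f A"

text \<open>
  Local states and communicated information are coded as natural numbers; as any countable
  types can be coded in this way, this does not restrict the algorithms in question.
\<close>

definition async_solvable :: "nat \<Rightarrow> 'v task set \<Rightarrow> bool" where
  "async_solvable f \<Pi> \<longleftrightarrow>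
     (\<exists>T \<in> \<Pi>. \<exists>A :: (nat, nat, 'v) algorithm. implements f A T)"

end

theory Submission
  imports Defs "HOL-Library.Countable"
begin

text \<open>
  As a task may support a single size, take \<open>n > f\<close> processes. A leader outputs the first
  entry of a word \<open>w\<close> of its choice and only then announces \<open>w\<close>. There are at least \<open>f\<close>
  voters. A voter that makes its first step before it hears of \<open>w\<close> outputs a default value
  \<open>a\<close>; otherwise it abstains from \<open>a\<close> and says so, and it outputs its entry of \<open>w\<close> once
  all voters are known to have abstained. Hence the outputs lie either in the set of entries of
  \<open>w\<close> or in \<open>{a, w\<^sub>0}\<close>, which has at most \<open>k\<close> elements since \<open>k \<ge> 2\<close>. Some process outputs:
  the leader or some voter is correct, and a voter abstains only after an output of the leader.
  The choice of the leader depends on which message of further helper processes reaches it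
  before its first step, so every word is chosen in some execution.
\<close>

section \<open>Finite histories\<close>

text \<open>Histories list the events of an execution prefix with the latest event first.\<close>

primrec hist_states ::
  "('s, 'm, 'v) algorithm \<Rightarrow> 'v option list \<Rightarrow> 'm event list \<Rightarrow> nat \<Rightarrow> 's"
where
  "hist_states A vin [] = (\<lambda>p. init A (length vin) p (vin ! p))"
| "hist_states A vin (e # h) =
     (let s = hist_states A vin h in
      case e of
        Step p \<Rightarrow> s(p := fst (local_step A (s p)))
      | Observe p q m \<Rightarrow> s(p := on_observe A m (s p))
      | Crash p \<Rightarrow> s
      | Idle \<Rightarrow> s)"

primrec hist_acts ::
  "('s, 'm, 'v) algorithm \<Rightarrow> 'v option list \<Rightarrow> 'm event list \<Rightarrow> (nat \<times> ('m, 'v) action) set"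
where
  "hist_acts A vin [] = {}"
| "hist_acts A vin (e # h) =
     (case e of
        Step p \<Rightarrow> insert (p, snd (local_step A (hist_states A vin h p))) (hist_acts A vin h)
      | _ \<Rightarrow> hist_acts A vin h)"

text \<open>This keeps the conditions on an execution that can be checked event by event: index
  bounds, validity and integrity. The safety claims below then go by induction on a history, and
  histories can be extended by hand.\<close>

primrec hist_ok :: "('s, 'm, 'v) algorithm \<Rightarrow> 'v option list \<Rightarrow> 'm event list \<Rightarrow> bool" where
  "hist_ok A vin [] \<longleftrightarrow> True"
| "hist_ok A vin (e # h) \<longleftrightarrow> hist_ok A vin h \<and>
     (case e of
        Step p \<Rightarrow> p < length vin
      | Observe p q m \<Rightarrow>
          p < length vin \<and> (q, Communicate m) \<in> hist_acts A vin h \<and> e \<notin> set h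
      | Crash p \<Rightarrow> p < length vin
      | Idle \<Rightarrow> True)"

definition hist :: "(nat \<Rightarrow> 'm event) \<Rightarrow> nat \<Rightarrow> 'm event list" where
  "hist \<sigma> t = rev (map \<sigma> [0..<t])"

lemma hist_simps [simp]: "hist \<sigma> 0 = []" "hist \<sigma> (Suc t) = \<sigma> t # hist \<sigma> t"
  by (simp_all add: hist_def)

lemma set_hist: "set (hist \<sigma> t) = \<sigma> ` {..<t}"
  by (auto simp: hist_def)

lemma local_states_hist: "local_states A vin \<sigma> t = hist_states A vin (hist \<sigma> t)"
  by (induction t) (auto simp: Let_def split: event.split)

lemma hist_acts_hist:
  "hist_acts A vin (hist \<sigma> t) = {(p, a). \<exists>t' < t. performs A vin \<sigma> t' p a}"
proof (induction t)
  case (Suc t)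
  then show ?case
    by (auto simp: performs_def local_states_hist less_Suc_eq split: event.splits)
qed auto

lemma performs_imp_hist_acts:
  "performs A vin \<sigma> t p a \<Longrightarrow> t < t' \<Longrightarrow> (p, a) \<in> hist_acts A vin (hist \<sigma> t')"
  by (auto simp: hist_acts_hist)

lemma hist_ok_hist:
  assumes "execution f A vin \<sigma>"
  shows "hist_ok A vin (hist \<sigma> t)"
proof (induction t)
  case (Suc t)
  have lt: "\<And>p. process_of (\<sigma> t) = Some p \<Longrightarrow> p < length vin"
    and val: "C_validity A vin \<sigma>" and int: "C_integrity \<sigma>"
    using assms by (auto simp: execution_def)
  show ?case
  proof (cases "\<sigma> t")
    case (Observe p q m)
    then have "(q, Communicate m) \<in> hist_acts A vin (hist \<sigma> t)"
      using val by (auto simp: C_validity_def hist_acts_hist)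
    moreover have "\<sigma> t \<notin> set (hist \<sigma> t)"
    proof
      assume "\<sigma> t \<in> set (hist \<sigma> t)"
      then obtain t' where "t' < t" "\<sigma> t' = \<sigma> t" by (auto simp: set_hist)
      then have "t = t'" using int Observe unfolding C_integrity_def by metis
      then show False using \<open>t' < t\<close> by simp
    qed
    ultimately show ?thesis using Suc lt Observe by simp
  qed (use Suc lt in auto)
qed auto

lemma finite_hist_acts: "finite (hist_acts A vin h)"
  by (induction h) (auto split: event.split)

lemma hist_acts_append_observes:
  assumes "\<forall>e \<in> set h'. \<exists>p q m. e = Observe p q m"
  shows "hist_acts A vin (h' @ h) = hist_acts A vin h"
  using assms by (induction h') (auto split: event.split)

section \<open>Completing finite histories to executions\<close>

definition delivered ::
  "('s, 'm, 'v) algorithm \<Rightarrow> 'v option list \<Rightarrow> 'm event list \<Rightarrow> bool" where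
  "delivered A vin h \<longleftrightarrow>
     (\<forall>q m. (q, Communicate m) \<in> hist_acts A vin h \<longrightarrow>
        (\<forall>p < length vin. Observe p q m \<in> set h))"

text \<open>An observation performs no action, so each one strictly shrinks the finite set
  \<open>F h\<close> of pending observations. Here \<open>delivered\<close> demands every
  observation by every process, which is enough for both termination properties.\<close>

lemma deliver_all:
  assumes "hist_ok A vin h"
  obtains h' where "hist_ok A vin (h' @ h)" "\<forall>e \<in> set h'. \<exists>p q m. e = Observe p q m"
    "delivered A vin (h' @ h)"
proof -
  define F where
    "F h = {(p, q, m). p < length vin \<and> (q, Communicate m) \<in> hist_acts A vin h \<and>
                       Observe p q m \<notin> set h}" for h
  have fin: "finite (F h)" for h
  proof -
    \<comment> \<open>The \<open>undefined\<close> branch is harmless, as only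
      \<open>Communicate\<close> actions contribute triples to \<open>F h\<close>.\<close>
    have "F h \<subseteq> {..<length vin} \<times>
        (\<lambda>(q, a). (q, case a of Communicate m \<Rightarrow> m | _ \<Rightarrow> undefined)) ` hist_acts A vin h"
      by (force simp: F_def)
    then show ?thesis
      by (rule finite_subset) (simp add: finite_hist_acts)
  qed
  have "\<exists>h'. hist_ok A vin (h' @ h) \<and> (\<forall>e \<in> set h'. \<exists>p q m. e = Observe p q m) \<and>
          F (h' @ h) = {}"
    using assms
  proof (induction "card (F h)" arbitrary: h rule: less_induct)
    case less
    show ?case
    proof (cases "F h = {}")
      case True
      then show ?thesis using less.prems by (intro exI[of _ "[]"]) simp
    next
      case False
      then obtain p q m where pqm: "(p, q, m) \<in> F h" by auto
      let ?h = "Observe p q m # h"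
      have "F ?h \<subseteq> F h" "(p, q, m) \<notin> F ?h" by (auto simp: F_def)
      then have "F ?h \<subset> F h" using pqm by blast
      then have "card (F ?h) < card (F h)" using fin by (intro psubset_card_mono)
      moreover have "hist_ok A vin ?h" using pqm less.prems by (simp add: F_def)
      ultimately obtain h' where "hist_ok A vin (h' @ ?h)"
        "\<forall>e \<in> set h'. \<exists>p q m. e = Observe p q m" "F (h' @ ?h) = {}"
        using less.hyps by blast
      then show ?thesis by (intro exI[of _ "h' @ [Observe p q m]"]) auto
    qed
  qed
  then show thesis using that by (force simp: F_def delivered_def)
qed

text \<open>
  A history without crashes in which nothing remains to be delivered extends to an execution
  by round robin once no process changes its state any more.
\<close>

lemma quiescent_execution:
  assumes ok: "hist_ok A vin h" and adm: "vin \<in> admitted A" and ne: "vin \<noteq> []"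
    and nocrash: "\<And>p. Crash p \<notin> set h" and del: "delivered A vin h"
    and quiet: "\<And>p. p < length vin \<Longrightarrow>
      local_step A (hist_states A vin h p) = (hist_states A vin h p, Skip)"
  obtains \<sigma> where "execution f A vin \<sigma>"
    "\<And>p a. a \<noteq> Skip \<Longrightarrow> (\<exists>t. performs A vin \<sigma> t p a) \<longleftrightarrow> (p, a) \<in> hist_acts A vin h"
proof -
  define n where "n = length vin"
  have n: "0 < n" using ne by (simp add: n_def)
  define \<sigma> where "\<sigma> t = (if t < length h then rev h ! t else Step (t mod n))" for t
  have hist_len: "hist \<sigma> (length h) = h"
  proof -
    have "map \<sigma> [0..<length h] = rev h"
      by (rule nth_equalityI) (auto simp: \<sigma>_def)
    then show ?thesis by (simp add: hist_def)
  qed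
  have late: "hist_states A vin (hist \<sigma> (length h + d)) = hist_states A vin h" for d
  proof (induction d)
    case (Suc d)
    have "\<sigma> (length h + d) = Step ((length h + d) mod n)" by (simp add: \<sigma>_def)
    moreover have "(length h + d) mod n < length vin" using n by (simp add: n_def)
    ultimately show ?case using Suc quiet by simp
  qed (simp add: hist_len)
  have late_skip: "a = Skip" if perf: "performs A vin \<sigma> t p a" and le: "length h \<le> t" for t p a
  proof -
    obtain d where t: "t = length h + d" using le le_Suc_ex by blast
    have "p = t mod n" using perf le by (auto simp: performs_def \<sigma>_def)
    then have "p < length vin" using n by (simp add: n_def)
    then show ?thesis using perf quiet by (simp add: performs_def local_states_hist t late)
  qed
  have acts: "(\<exists>t. performs A vin \<sigma> t p a) \<longleftrightarrow> (p, a) \<in> hist_acts A vin h" if "a \<noteq> Skip" for p a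
  proof -
    have "(p, a) \<in> hist_acts A vin h \<longleftrightarrow> (\<exists>t < length h. performs A vin \<sigma> t p a)"
      using hist_acts_hist[of A vin \<sigma> "length h"] by (simp add: hist_len)
    then show ?thesis using late_skip that by (meson not_le)
  qed
  have in_h: "\<sigma> t \<in> set h" if "t < length h" for t
    using that nth_mem[of t "rev h"] by (simp add: \<sigma>_def)
  have from_h: "\<exists>t. \<sigma> t = e" if "e \<in> set h" for e
    using that hist_len set_hist[of \<sigma> "length h"] by auto
  have obs_early: "t < length h" if "\<sigma> t = Observe p q m" for t p q m
    using that by (auto simp: \<sigma>_def split: if_splits)
  have ok_take: "hist_ok A vin (hist \<sigma> t)" if "t \<le> length h" for t
    using that
  \<comment> \<open>Downward induction from \<open>length h\<close>: \<open>hist_ok\<close> passes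
    to the history without its latest event.\<close>
  proof (induction t rule: inc_induct)
    case base
    then show ?case using ok hist_len by simp
  next
    case (step t)
    then show ?case by simp
  qed
  have "\<not> (\<sigma> t = Crash p)" for t p
    using in_h nocrash[of p] by (cases "t < length h") (metis, simp add: \<sigma>_def)
  then have nocr: "crashed n \<sigma> = {}" "\<And>t p. \<sigma> t \<noteq> Crash p" by (auto simp: crashed_def)
  then have corr: "correct n \<sigma> = {p. p < n}" by (simp add: correct_def)
  have "\<forall>t p. process_of (\<sigma> t) = Some p \<longrightarrow> p < length vin"
  proof (intro allI impI)
    fix t p assume *: "process_of (\<sigma> t) = Some p"
    show "p < length vin"
    proof (cases "t < length h")
      case True
      then show ?thesis using ok_take[of "Suc t"] * by (cases "\<sigma> t") auto
    next
      case False
      then show ?thesis using * n by (auto simp: \<sigma>_def n_def)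
    qed
  qed
  moreover have "infinite {t. \<sigma> t = Step p}" if "p < n" for p
  proof -
    have "\<exists>t \<ge> b. \<sigma> t = Step p" for b
    proof (intro exI conjI)
      \<comment> \<open>This time is congruent to \<open>p\<close> modulo \<open>n\<close> and
        precedes neither \<open>b\<close> nor the end of the replayed history.\<close>
      let ?t = "p + n * (b + length h)"
      have "b + length h \<le> n * (b + length h)" using n by simp
      then have "b + length h \<le> ?t" by linarith
      then show "b \<le> ?t" "\<sigma> ?t = Step p" using that by (simp_all add: \<sigma>_def)
    qed
    then show ?thesis unfolding finite_nat_set_iff_bounded by (metis mem_Collect_eq not_le)
  qed
  moreover have "C_validity A vin \<sigma>"
    unfolding C_validity_def
  proof (intro allI impI)
    fix t p q m assume *: "\<sigma> t = Observe p q m"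
    have "(q, Communicate m) \<in> hist_acts A vin (hist \<sigma> t)"
      using ok_take[of "Suc t"] obs_early[OF *] * by simp
    then show "\<exists>t' < t. performs A vin \<sigma> t' q (Communicate m)" by (simp add: hist_acts_hist)
  qed
  moreover have "C_integrity \<sigma>"
  proof -
    have "\<not> t < t'" if "\<sigma> t = Observe p q m" "\<sigma> t' = Observe p q m" for t t' p q m
    proof
      assume "t < t'"
      then have "\<sigma> t \<in> set (hist \<sigma> t')" by (simp add: set_hist)
      then show False using ok_take[of "Suc t'"] obs_early[OF that(2)] that by simp
    qed
    then show ?thesis unfolding C_integrity_def by (metis linorder_neqE_nat)
  qed
  moreover have "C_local_termination A vin \<sigma>"
    unfolding C_local_termination_def
  proof (intro allI impI, elim conjE)
    fix t q m
    assume "q \<in> correct (length vin) \<sigma>" and p: "performs A vin \<sigma> t q (Communicate m)"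
    have "(q, Communicate m) \<in> hist_acts A vin h" using acts p by blast
    then have "Observe 0 q m \<in> set h" using del n by (simp add: delivered_def n_def)
    then show "\<exists>p \<in> correct (length vin) \<sigma>. \<exists>t'. \<sigma> t' = Observe p q m"
      using from_h corr n by (force simp: n_def)
  qed
  moreover have "C_global_termination n \<sigma>"
    unfolding C_global_termination_def
  proof (intro allI impI ballI, elim conjE)
    fix t p q m p'
    assume "p \<in> correct n \<sigma>" and o: "\<sigma> t = Observe p q m" and p': "p' \<in> correct n \<sigma>"
    have "(q, Communicate m) \<in> hist_acts A vin (hist \<sigma> t)"
      using ok_take[of "Suc t"] obs_early[OF o] o by simp
    then have "(q, Communicate m) \<in> hist_acts A vin h"
      using acts by (auto simp: hist_acts_hist)
    then have "Observe p' q m \<in> set h" using del p' corr by (simp add: delivered_def n_def)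
    then show "\<exists>t'. \<sigma> t' = Observe p' q m" by (rule from_h)
  qed
  ultimately have "execution f A vin \<sigma>"
    using adm nocr corr by (auto simp: execution_def n_def)
  then show thesis using that acts by blast
qed


section \<open>The algorithm\<close>

text \<open>Messages must be numbers; even codes for \<open>present\<close> and odd codes for
  \<open>choice\<close> keep the two kinds apart.\<close>

definition present :: "nat \<Rightarrow> nat" where "present p = 2 * p"

definition choice :: "nat \<Rightarrow> nat" where "choice c = Suc (2 * c)"

lemma message_simps [simp]:
  "present p = present q \<longleftrightarrow> p = q" "choice c = choice d \<longleftrightarrow> c = d"
  "present p \<noteq> choice c" "choice c \<noteq> present p"
  unfolding present_def choice_def by presburger+

text \<open>\<open>Chosen c\<close> is needed because a step performs one action only: the leader
  has output its entry but not yet announced \<open>c\<close>. Helpers remain in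
  \<open>Waiting\<close> forever.\<close>

datatype phase = Start | Chosen nat | Waiting | Done

instance phase :: countable
  by countable_datatype

text \<open>A local state consists of the index of the process, its phase and the observed messages.\<close>

type_synonym pstate = "nat \<times> phase \<times> nat list"

text \<open>
  Process \<open>0\<close> is the leader, \<open>1, \<dots>, m - 1\<close> are the voters, and all further processes are
  helpers. The words \<open>w c\<close> encode the output sets: if the choice \<open>c\<close> of the leader prevails,
  process \<open>p < m\<close> outputs \<open>w c p\<close>. Which choice the leader makes depends on the helpers that
  it has heard of; \<open>SOME\<close> may yield any number at all here, as every \<open>w c\<close> is admissible.
\<close>

fun pstep :: "nat \<Rightarrow> (nat \<Rightarrow> nat \<Rightarrow> 'v) \<Rightarrow> 'v \<Rightarrow> pstate \<Rightarrow> pstate \<times> (nat, 'v) action" where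
  "pstep m w a (p, Start, l) =
     (if p = 0 then
        let c = SOME c. present (m + c) \<in> set l in ((p, Chosen c, l), Output (w c 0))
      else if p < m \<and> (\<forall>c. choice c \<notin> set l) then ((p, Done, l), Output a)
      else ((p, Waiting, l), Communicate (present p)))"
| "pstep m w a (p, Chosen c, l) = ((p, Done, l), Communicate (choice c))"
| "pstep m w a (p, Waiting, l) =
     (if p < m \<and> (\<forall>j \<in> {1..<m}. present j \<in> set l)
      then ((p, Done, l), Output (w (SOME c. choice c \<in> set l) p))
      else ((p, Waiting, l), Skip))"
| "pstep m w a (p, Done, l) = ((p, Done, l), Skip)"

definition word_alg :: "nat \<Rightarrow> nat \<Rightarrow> (nat \<Rightarrow> nat \<Rightarrow> 'v) \<Rightarrow> 'v \<Rightarrow> (nat, nat, 'v) algorithm" where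
  "word_alg n m w a =
     \<lparr>admitted = {replicate n None},
      init = \<lambda>n p x. to_nat (p, Start, [] :: nat list),
      local_step = \<lambda>s. apfst to_nat (pstep m w a (from_nat s)),
      on_observe = \<lambda>x s. case from_nat s :: pstate of (p, ph, l) \<Rightarrow> to_nat (p, ph, x # l)\<rparr>"

locale word_algorithm =
  fixes n m :: nat and w :: "nat \<Rightarrow> nat \<Rightarrow> 'v" and a :: 'v
  assumes m: "0 < m" "m \<le> n"
begin

abbreviation "A \<equiv> word_alg n m w a"
abbreviation "vin \<equiv> replicate n (None :: 'v option)"
abbreviation "acts \<equiv> hist_acts A vin"
abbreviation "ok \<equiv> hist_ok A vin"

section \<open>Decoded local states and their transition rules\<close>

definition ph :: "nat event list \<Rightarrow> nat \<Rightarrow> phase" where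
  "ph h p = fst (snd (from_nat (hist_states A vin h p) :: pstate))"

definition log :: "nat event list \<Rightarrow> nat \<Rightarrow> nat list" where
  "log h p = snd (snd (from_nat (hist_states A vin h p) :: pstate))"

text \<open>No transition changes the index, so every reachable state is the code of a triple
  starting with it. From here on, \<open>ph\<close>, \<open>log\<close> and \<open>acts\<close>
  replace the coded states.\<close>

lemma hist_states_eq: "hist_states A vin h p = to_nat (p, ph h p, log h p)"
proof -
  have "\<exists>f l. hist_states A vin h p = to_nat (p, f :: phase, l :: nat list)" for p
  proof (induction h arbitrary: p)
    case Nil
    then show ?case by (auto simp: word_alg_def)
  next
    case (Cons e h)
    obtain f l where fl: "hist_states A vin h p = to_nat (p, f :: phase, l :: nat list)"
      using Cons by blast
    show ?case
    proof (cases e)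
      case (Step q)
      have "\<exists>f' l'. fst (pstep m w a (p, f, l)) = (p, f', l')"
        by (cases f) (auto simp: Let_def)
      then obtain f' l' where "fst (pstep m w a (p, f, l)) = (p, f', l')" by blast
      then show ?thesis using Step fl
        by (cases "p = q") (auto simp: word_alg_def Let_def)
    next
      case (Observe q r x)
      then show ?thesis using fl by (cases "p = q") (auto simp: word_alg_def Let_def)
    qed (use fl in auto)
  qed
  then show ?thesis unfolding ph_def log_def by (metis from_nat_to_nat fst_conv snd_conv)
qed

lemma local_step_eq: "local_step A (hist_states A vin h p) =
    apfst to_nat (pstep m w a (p, ph h p, log h p))"
  by (simp add: hist_states_eq) (simp add: word_alg_def)

lemma Nil_simps [simp]: "ph [] p = Start" "log [] p = []"
  by (simp_all add: ph_def log_def word_alg_def)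

lemma Step_simps [simp]:
  "ph (Step q # h) p =
     (if p = q then fst (snd (fst (pstep m w a (p, ph h p, log h p)))) else ph h p)"
  "log (Step q # h) p = log h p"
  "acts (Step q # h) = insert (q, snd (pstep m w a (q, ph h q, log h q))) (acts h)"
proof -
  show "acts (Step q # h) = insert (q, snd (pstep m w a (q, ph h q, log h q))) (acts h)"
    by (simp add: local_step_eq)
  show "ph (Step q # h) p =
     (if p = q then fst (snd (fst (pstep m w a (p, ph h p, log h p)))) else ph h p)"
    by (simp add: ph_def[of "_ # _"] local_step_eq) (simp add: ph_def)
  have "snd (snd (fst (pstep m w a (p, f, l)))) = l" for p f l
    by (cases f) (auto simp: Let_def)
  then show "log (Step q # h) p = log h p"
    by (simp add: log_def[of "_ # _"] local_step_eq) (simp add: log_def)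
qed

lemma Observe_simps [simp]:
  "ph (Observe q r x # h) p = ph h p"
  "log (Observe q r x # h) p = (if p = q then x # log h p else log h p)"
proof -
  have "on_observe A x (hist_states A vin h q) = to_nat (q, ph h q, x # log h q)"
    by (simp add: hist_states_eq) (simp add: word_alg_def)
  then show "ph (Observe q r x # h) p = ph h p"
    "log (Observe q r x # h) p = (if p = q then x # log h p else log h p)"
    by (simp_all add: ph_def[of "_ # _"] log_def[of "_ # _"]) (simp_all add: ph_def log_def)
qed

lemma other_simps [simp]:
  "ph (Crash q # h) p = ph h p" "log (Crash q # h) p = log h p"
  "ph (Idle # h) p = ph h p" "log (Idle # h) p = log h p"
  by (simp_all add: ph_def log_def)

lemma acts_simps [simp]:
  "acts [] = {}" "acts (Observe q r x # h) = acts h" "acts (Crash q # h) = acts h"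
  "acts (Idle # h) = acts h"
  by simp_all

declare hist_acts.simps(2) [simp del] hist_states.simps(2) [simp del]

section \<open>Invariants of histories\<close>

lemma pstep_cases:
  obtains (skip) "snd (pstep m w a (p, f, l)) = Skip" "fst (snd (fst (pstep m w a (p, f, l)))) = f"
    | (choose) c where "p = 0" "f = Start" "snd (pstep m w a (p, f, l)) = Output (w c 0)"
        "fst (snd (fst (pstep m w a (p, f, l)))) = Chosen c"
    | (default) "0 < p" "p < m" "f = Start" "snd (pstep m w a (p, f, l)) = Output a"
        "fst (snd (fst (pstep m w a (p, f, l)))) = Done"
    | (present) "0 < p" "f = Start" "p < m \<Longrightarrow> \<exists>c. choice c \<in> set l"
        "snd (pstep m w a (p, f, l)) = Communicate (present p)"
        "fst (snd (fst (pstep m w a (p, f, l)))) = Waiting"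
    | (announce) c where "f = Chosen c" "snd (pstep m w a (p, f, l)) = Communicate (choice c)"
        "fst (snd (fst (pstep m w a (p, f, l)))) = Done"
    | (vote) "f = Waiting" "p < m" "\<forall>j \<in> {1..<m}. present j \<in> set l"
        "snd (pstep m w a (p, f, l)) = Output (w (SOME c. choice c \<in> set l) p)"
        "fst (snd (fst (pstep m w a (p, f, l)))) = Done"
proof (cases f)
  case Start
  then show thesis using choose default present
    by (cases "p = 0"; cases "p < m \<and> (\<forall>c. choice c \<notin> set l)") (auto simp: Let_def)
next
  case (Chosen c)
  then show thesis using announce by auto
next
  case Waiting
  then show thesis using skip vote
    by (cases "p < m \<and> (\<forall>j \<in> {1..<m}. present j \<in> set l)") auto
next
  case Done
  then show thesis using skip by auto
qed

text \<open>Outputs are performed only in \<open>Start\<close> or \<open>Waiting\<close> and lead to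
  \<open>Chosen\<close> or \<open>Done\<close>; this gives the second claim and from it the third.
  The first claim shows that an announcement comes from the leader, after its output, as the fourth
  requires.\<close>

lemma action_invariants:
  shows "ph h p = Chosen c \<Longrightarrow> p = 0 \<and> (0, Output (w c 0)) \<in> acts h"
    and "(p, Output v) \<in> acts h \<Longrightarrow> ph h p \<noteq> Start \<and> ph h p \<noteq> Waiting"
    and "(p, Output v) \<in> acts h \<Longrightarrow> (p, Output v') \<in> acts h \<Longrightarrow> v = v'"
    and "(p, Communicate x) \<in> acts h \<Longrightarrow>
      (\<exists>c. p = 0 \<and> x = choice c \<and> ph h 0 = Done \<and> (0, Output (w c 0)) \<in> acts h) \<or>
      (x = present p \<and> 0 < p \<and> ph h p \<noteq> Start)"
proof (induction h arbitrary: p c v v' x)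
  case (Cons e h)
  note IH = Cons.IH
  {
    case 1
    then show ?case
    proof (cases e)
      case (Step r)
      then show ?thesis using 1 IH(1)[of p c]
        by (cases rule: pstep_cases[of p "ph h p" "log h p"]) (auto split: if_splits)
    qed (use 1 IH(1)[of p c] in auto)
  next
    case 2
    then show ?case
    proof (cases e)
      case (Step r)
      then show ?thesis using 2 IH(2)[of p v]
        by (cases rule: pstep_cases[of p "ph h p" "log h p"]) (auto split: if_splits)
    qed (use 2 IH(2)[of p v] in auto)
  next
    case 3
    then show ?case
    proof (cases e)
      case (Step r)
      then show ?thesis using 3 IH(2)[of p v] IH(2)[of p v'] IH(3)[of p v v']
        by (cases rule: pstep_cases[of p "ph h p" "log h p"]) (auto split: if_splits)
    qed (use 3 IH(3)[of p v v'] in auto)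
  next
    case 4
    then show ?case
    proof (cases e)
      case (Step r)
      then show ?thesis using 4 IH(4)[of p x] IH(1)[of p]
        by (cases rule: pstep_cases[of r "ph h r" "log h r"]) (auto split: if_splits)
    qed (use 4 IH(4)[of p x] in auto)
  }
qed simp_all

text \<open>An announcement requires phase \<open>Chosen\<close>, but an earlier one has left the
  leader in \<open>Done\<close>.\<close>

lemma choice_unique:
  "(p, Communicate (choice c)) \<in> acts h \<Longrightarrow> (q, Communicate (choice d)) \<in> acts h \<Longrightarrow> c = d"
proof (induction h)
  case (Cons e h)
  show ?case
  proof (cases e)
    case (Step r)
    then show ?thesis
      using Cons action_invariants(4)[of p "choice c" h] action_invariants(4)[of q "choice d" h]
        action_invariants(1)[of h p] action_invariants(1)[of h q]
      by (cases rule: pstep_cases[of r "ph h r" "log h r"]) (auto split: if_splits)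
  qed (use Cons in auto)
qed simp

lemma log_communicated:
  assumes "ok h" "x \<in> set (log h p)"
  obtains q where "(q, Communicate x) \<in> acts h"
proof -
  have "\<exists>q. (q, Communicate x) \<in> acts h" using assms
  proof (induction h)
    case (Cons e h)
    then show ?case by (cases e) (simp_all split: if_splits, blast+)
  qed simp
  then show thesis using that by blast
qed

text \<open>The log does not record senders, but the message determines its sender by
  \<open>action_invariants(4)\<close>.\<close>

lemma log_present:
  assumes "ok h" "present j \<in> set (log h p)"
  shows "(j, Communicate (present j)) \<in> acts h"
proof -
  obtain q where q: "(q, Communicate (present j)) \<in> acts h"
    using assms by (rule log_communicated)
  then show ?thesis using action_invariants(4)[OF q] by simp
qed

lemma log_choice:
  assumes "ok h" "choice c \<in> set (log h p)"
  shows "(0, Communicate (choice c)) \<in> acts h"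
proof -
  obtain q where q: "(q, Communicate (choice c)) \<in> acts h"
    using assms by (rule log_communicated)
  then show ?thesis using action_invariants(4)[OF q] by auto
qed

text \<open>A voter enters \<open>Waiting\<close> only with an announcement in its log, and logs
  never shrink. Hence the \<open>SOME\<close> in a vote picks a choice that was really
  announced.\<close>

lemma waiting_heard_choice:
  assumes "ph h p = Waiting" "p < m"
  shows "\<exists>c. choice c \<in> set (log h p)"
  using assms(1)
proof (induction h)
  case (Cons e h)
  show ?case
  proof (cases e)
    case (Step r)
    show ?thesis
    proof (cases "ph h p = Waiting")
      case True
      then show ?thesis using Cons.IH Step by simp
    next
      case False
      then show ?thesis using Cons.prems Step assms(2)
        by (cases rule: pstep_cases[of p "ph h p" "log h p"]) (simp_all split: if_splits)
    qed
  next
    case (Observe q r x)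
    then have "ph h p = Waiting" using Cons.prems by simp
    then obtain c where "choice c \<in> set (log h p)" using Cons.IH by blast
    then have "choice c \<in> set (log (e # h) p)" using Observe by auto
    then show ?thesis ..
  qed (use Cons in simp_all)
qed simp

text \<open>A voter that outputs the default goes straight to \<open>Done\<close> and never sends
  its presence, whereas a vote needs the presence of all voters. So the two alternatives cannot
  occur for two voters in the same history.\<close>

lemma voter_output:
  "ok h \<Longrightarrow> (p, Output v) \<in> acts h \<Longrightarrow> 0 < p \<Longrightarrow> p < m \<and>
    (v = a \<and> (p, Communicate (present p)) \<notin> acts h \<or>
     (\<exists>c. (0, Communicate (choice c)) \<in> acts h \<and> v = w c p \<and>
        (\<forall>j \<in> {1..<m}. (j, Communicate (present j)) \<in> acts h)))"
proof (induction h)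
  case (Cons e h)
  have ok: "ok h" using Cons.prems by simp
  show ?case
  proof (cases e)
    case (Step r)
    note inv = action_invariants(2)[of p v h] action_invariants(4)[of p "present p" h]
      log_present[OF ok, of _ p]
    show ?thesis
    proof (cases rule: pstep_cases[of r "ph h r" "log h r"])
      case vote
      then obtain d where "choice d \<in> set (log h r)" using waiting_heard_choice[of h r] by auto
      then have c: "choice (SOME c. choice c \<in> set (log h r)) \<in> set (log h r)"
        by (rule someI)
      show ?thesis
      proof (cases "r = p \<and> (p, Output v) \<notin> acts h")
        case True
        have "v = w (SOME c. choice c \<in> set (log h r)) p"
          using True Cons.prems(2) Step vote(4) by simp
        moreover have "(0, Communicate (choice (SOME c. choice c \<in> set (log h r)))) \<in> acts h"
          using log_choice[OF ok c] .
        moreover have "\<forall>j \<in> {1..<m}. (j, Communicate (present j)) \<in> acts h"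
          using vote(3) log_present[OF ok] by blast
        ultimately show ?thesis using True Step vote(2) by auto
      next
        case False
        then have "(p, Output v) \<in> acts h" using Cons.prems(2) Step vote(4) by auto
        then show ?thesis using Cons.IH[OF ok] Cons.prems(3) Step vote(4) by auto
      qed
    qed (use Cons Step inv in auto)
  qed (use Cons in auto)
qed simp

text \<open>On leaving \<open>Start\<close>, a process below \<open>m\<close> either outputs or has
  heard an announcement, which the leader makes only after its own output. The first induction shows
  that a step leaves \<open>Start\<close> for good, the second finds the output.\<close>

lemma stepped_imp_output:
  assumes "ok h" "Step p \<in> set h" "p < m"
  shows "\<exists>q v. (q, Output v) \<in> acts h"
proof -
  have "ph h p \<noteq> Start" using assms(2)
  proof (induction h)
    case (Cons e h)
    show ?case
    proof (cases e)
      case (Step r)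
      then show ?thesis using Cons
        by (cases rule: pstep_cases[of p "ph h p" "log h p"])
          (auto split: if_splits simp: Let_def)
    qed (use Cons in auto)
  qed simp
  then show ?thesis using assms(1)
  proof (induction h)
    case (Cons e h)
    show ?case
    proof (cases e)
      case (Step r)
      show ?thesis
      proof (cases rule: pstep_cases[of r "ph h r" "log h r"])
        case present
        show ?thesis
        proof (cases "r = p")
          case True
          then obtain c where "choice c \<in> set (log h p)" using present assms(3) by auto
          then have "(0, Communicate (choice c)) \<in> acts h" using log_choice Cons.prems by auto
          then show ?thesis using action_invariants(4)[of 0 "choice c" h] Step by auto
        next
          case False
          then show ?thesis using Cons Step by auto
        qed
      qed (use Cons Step in \<open>auto split: if_splits\<close>)
    qed (use Cons in auto)
  qed simp
qed

lemma leader_output: "(0, Output v) \<in> acts h \<Longrightarrow> \<exists>c. v = w c 0"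
proof (induction h)
  case (Cons e h)
  show ?case
  proof (cases e)
    case (Step r)
    then show ?thesis using Cons
      by (cases rule: pstep_cases[of r "ph h r" "log h r"]) auto
  qed (use Cons in auto)
qed simp

text \<open>If a choice has been announced and all voters are present, no voter has output the
  default, and all outputs are entries of the one announced word. Otherwise nobody has voted, so the
  outputs are at most the default and the leader's entry.\<close>

lemma history_outputs:
  assumes "ok h"
  obtains c where "{v. \<exists>p. (p, Output v) \<in> acts h} \<subseteq> w c ` {..<m}"
    | c where "{v. \<exists>p. (p, Output v) \<in> acts h} \<subseteq> {a, w c 0}"
proof (cases "\<exists>c. (0, Communicate (choice c)) \<in> acts h \<and>
    (\<forall>j \<in> {1..<m}. (j, Communicate (present j)) \<in> acts h)")
  case True
  then obtain c where c: "(0, Communicate (choice c)) \<in> acts h"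
    and present: "\<And>j. 0 < j \<Longrightarrow> j < m \<Longrightarrow> (j, Communicate (present j)) \<in> acts h"
    by auto
  have "v \<in> w c ` {..<m}" if v: "(p, Output v) \<in> acts h" for p v
  proof (cases "p = 0")
    case True
    have "(0, Output (w c 0)) \<in> acts h" using action_invariants(4)[OF c] by auto
    then have "v = w c 0" using v True action_invariants(3) by blast
    then show ?thesis using m by simp
  next
    case False
    then obtain d where "p < m" "(0, Communicate (choice d)) \<in> acts h" "v = w d p"
      using voter_output[OF assms v] present by auto
    then show ?thesis using choice_unique[OF c] by auto
  qed
  then show thesis by (intro that(1)) auto
next
  case False
  \<comment> \<open>The leader has at most one output value; if it has none, any \<open>c\<close>
    will do.\<close>
  obtain c where "\<And>v. (0, Output v) \<in> acts h \<Longrightarrow> v = w c 0"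
    using leader_output action_invariants(3) by metis
  moreover have "v = a" if "(p, Output v) \<in> acts h" "0 < p" for p v
    using voter_output[OF assms that] False by blast
  ultimately have "v \<in> {a, w c 0}" if "(p, Output v) \<in> acts h" for p v
    using that by (cases "p = 0") auto
  then show thesis by (intro that(2)[of c]) blast
qed

section \<open>Validity of the algorithm and safety of its executions\<close>

lemma admitted_eq [simp]: "admitted A = {vin}"
  by (simp add: word_alg_def)

text \<open>After an output the phase is neither \<open>Start\<close> nor \<open>Waiting\<close>,
  and no other phase outputs. Used in both directions, this gives equal times.\<close>

lemma output_once_ordered:
  assumes "performs A vin \<sigma> t p (Output v)" "performs A vin \<sigma> t' p (Output v')"
  shows "\<not> t < t'"
proof
  assume "t < t'"
  then have "(p, Output v) \<in> acts (hist \<sigma> t')"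
    using assms(1) by (auto simp: hist_acts_hist)
  then have "ph (hist \<sigma> t') p \<noteq> Start" "ph (hist \<sigma> t') p \<noteq> Waiting"
    by (simp_all add: action_invariants(2))
  moreover have "snd (pstep m w a (p, ph (hist \<sigma> t') p, log (hist \<sigma> t') p)) = Output v'"
    using assms(2) by (simp add: performs_def local_states_hist local_step_eq)
  ultimately show False by (cases "ph (hist \<sigma> t') p") auto
qed

lemma valid:
  assumes "f \<le> n"
  shows "valid_algorithm f A"
  unfolding valid_algorithm_def
proof (intro conjI ballI allI impI, goal_cases)
  case (3 xs \<sigma> t t' p v v')
  then have "xs = vin" by (simp add: execution_def)
  then show ?case using 3 output_once_ordered by (metis linorder_neqE_nat)
qed (use m assms in auto)

lemma output_set_eq:
  assumes "execution f A vin \<sigma>"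
  shows "output_set (output_vector A vin \<sigma>) = {v. \<exists>p t. performs A vin \<sigma> t p (Output v)}"
proof -
  have lt: "p < n" if "performs A vin \<sigma> t p (Output v)" for t p v
  proof -
    have "process_of (\<sigma> t) = Some p" using that by (simp add: performs_def)
    then have "p < length vin" using assms unfolding execution_def by blast
    then show ?thesis by simp
  qed
  have the: "(THE v. \<exists>t. performs A vin \<sigma> t p (Output v)) = v"
    if "performs A vin \<sigma> t p (Output v)" for t p v
  proof (rule the_equality)
    show "\<exists>t. performs A vin \<sigma> t p (Output v)" using that by blast
    fix u assume "\<exists>t. performs A vin \<sigma> t p (Output u)"
    then obtain t' where u: "performs A vin \<sigma> t' p (Output u)" by blast
    then have "t = t'" using that output_once_ordered by (metis linorder_neqE_nat)
    then show "u = v" using u that by (simp add: performs_def)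
  qed
  show ?thesis
  proof (intro set_eqI iffI)
    fix v assume "v \<in> output_set (output_vector A vin \<sigma>)"
    then obtain p t u where "performs A vin \<sigma> t p (Output u)"
      "v = (THE v. \<exists>t. performs A vin \<sigma> t p (Output v))"
      by (auto simp: output_set_def output_vector_def split: if_splits)
    then show "v \<in> {v. \<exists>p t. performs A vin \<sigma> t p (Output v)}" using the by blast
  next
    fix v assume "v \<in> {v. \<exists>p t. performs A vin \<sigma> t p (Output v)}"
    then obtain p t where p: "performs A vin \<sigma> t p (Output v)" by blast
    then have "output_vector A vin \<sigma> ! p = Some v" "p < length (output_vector A vin \<sigma>)"
      using lt[OF p] the[OF p] by (auto simp: output_vector_def)
    then show "v \<in> output_set (output_vector A vin \<sigma>)"
      unfolding output_set_def by (metis mem_Collect_eq nth_mem)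
  qed
qed

text \<open>Both claims reduce to a finite prefix: for the first, one containing a step of a correct
  process below \<open>m\<close>; for the second, one long enough to contain an occurrence of each
  of the finitely many output values.\<close>

lemma execution_outputs:
  assumes ex: "execution f A vin \<sigma>" and f: "f < m"
  defines "S \<equiv> output_set (output_vector A vin \<sigma>)"
  shows "S \<noteq> {}" and "\<exists>c. S \<subseteq> w c ` {..<m} \<or> S \<subseteq> {a, w c 0}"
proof -
  have ok: "ok (hist \<sigma> t)" for t using hist_ok_hist[OF ex] .
  \<comment> \<open>The leader and the voters number \<open>m > f\<close>, so they cannot all
    crash.\<close>
  have "\<not> {..<m} \<subseteq> crashed n \<sigma>"
  proof
    assume "{..<m} \<subseteq> crashed n \<sigma>"
    moreover have "finite (crashed n \<sigma>)" by (simp add: crashed_def)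
    ultimately have "m \<le> card (crashed n \<sigma>)" using card_mono[of "crashed n \<sigma>" "{..<m}"] by simp
    then show False using ex f by (simp add: execution_def)
  qed
  then obtain p where p: "p < m" "p \<in> correct n \<sigma>" using m by (auto simp: correct_def)
  then have "infinite {t. \<sigma> t = Step p}" using ex by (simp add: execution_def)
  then obtain t where "\<sigma> t = Step p" using not_finite_existsD by auto
  then have "Step p \<in> set (hist \<sigma> (Suc t))" by simp
  then obtain q v where "(q, Output v) \<in> acts (hist \<sigma> (Suc t))"
    using stepped_imp_output[OF ok _ p(1)] by blast
  then have "\<exists>t. performs A vin \<sigma> t q (Output v)" by (auto simp only: hist_acts_hist)
  then show "S \<noteq> {}" by (auto simp: S_def output_set_eq[OF ex])
  have "finite S"
  proof -
    have "Some ` S \<subseteq> set (output_vector A vin \<sigma>)" by (auto simp: S_def output_set_def)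
    then show ?thesis using finite_subset finite_imageD by (metis List.finite_set inj_Some)
  qed
  moreover have "\<forall>v \<in> S. \<exists>t. \<exists>p. performs A vin \<sigma> t p (Output v)"
    by (auto simp: S_def output_set_eq[OF ex])
  ultimately obtain \<tau> where \<tau>: "\<forall>v \<in> S. \<exists>p. performs A vin \<sigma> (\<tau> v) p (Output v)"
    by metis
  define T where "T = Suc (Max (\<tau> ` S))"
  have "S \<subseteq> {v. \<exists>p. (p, Output v) \<in> acts (hist \<sigma> T)}"
  proof
    fix v assume v: "v \<in> S"
    then have "\<tau> v < T" using \<open>finite S\<close> by (simp add: T_def less_Suc_eq_le)
    moreover obtain p where "performs A vin \<sigma> (\<tau> v) p (Output v)" using \<tau> v by blast
    ultimately show "v \<in> {v. \<exists>p. (p, Output v) \<in> acts (hist \<sigma> T)}"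
      using performs_imp_hist_acts by blast
  qed
  then show "\<exists>c. S \<subseteq> w c ` {..<m} \<or> S \<subseteq> {a, w c 0}"
    by (cases rule: history_outputs[OF ok[of T]]) blast+
qed

section \<open>An execution for each word\<close>

lemma observed_in_log: "Observe p q x \<in> set h \<Longrightarrow> x \<in> set (log h p)"
proof (induction h)
  case (Cons e h)
  then show ?case by (cases e) auto
qed simp

lemma ph_append_observes:
  assumes "\<forall>e \<in> set h'. \<exists>p q x. e = Observe p q x"
  shows "ph (h' @ h) p = ph h p"
  using assms by (induction h') auto

lemma delivered_log:
  assumes "delivered A vin h" "(q, Communicate x) \<in> acts h" "p < n"
  shows "x \<in> set (log h p)"
  using assms by (intro observed_in_log[of p q]) (simp add: delivered_def)

text \<open>A step touches only the phase of its own process, so processes that step once each all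
  act on their state in \<open>h\<close>, whatever the order.\<close>

lemma step_each:
  assumes "distinct ps"
  shows "ph (map Step ps @ h) p =
      (if p \<in> set ps then fst (snd (fst (pstep m w a (p, ph h p, log h p)))) else ph h p)"
    and "log (map Step ps @ h) p = log h p"
    and "acts (map Step ps @ h) =
      (\<lambda>p. (p, snd (pstep m w a (p, ph h p, log h p)))) ` set ps \<union> acts h"
    and "ok (map Step ps @ h) \<longleftrightarrow> ok h \<and> set ps \<subseteq> {..<n}"
  using assms
proof (induction ps arbitrary: p)
  case (Cons q ps)
  {
    case 1
    then show ?case by (auto simp: Cons.IH(1,2))
  next
    case 2
    then show ?case by (simp add: Cons.IH(2))
  next
    case 3
    then show ?case by (simp add: Cons.IH)
  next
    case 4
    then show ?case by (auto simp: Cons.IH(4))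
  }
qed simp_all

text \<open>Helper \<open>m + c\<close> steers the leader towards \<open>c\<close>. Full delivery
  before the first steps of the voters prevents the default, and full delivery afterwards lets them
  all vote. Nobody crashes, so \<open>f\<close> is arbitrary.\<close>

lemma execution_exists:
  assumes c: "m + c < n"
  obtains \<sigma> where "execution f A vin \<sigma>"
    "output_set (output_vector A vin \<sigma>) = w c ` {..<m}"
proof -
  \<comment> \<open>Read from right to left: the helper sends its presence, the leader observes it,
    outputs \<open>w c 0\<close> and announces \<open>c\<close>. The leader's log has one entry, so
    its \<open>SOME\<close> yields exactly \<open>c\<close>.\<close>
  define h1 where
    "h1 = [Step 0, Step 0, Observe 0 (m + c) (present (m + c)), Step (m + c)]"
  have h1: "acts h1 = {(m + c, Communicate (present (m + c))), (0, Output (w c 0)),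
        (0, Communicate (choice c))}"
    "ph h1 p = (if p = 0 then Done else if p = m + c then Waiting else Start)" "ok h1" for p
    using m c by (auto simp: h1_def Let_def)
  obtain d1 where d1: "ok (d1 @ h1)" "\<forall>e \<in> set d1. \<exists>p q x. e = Observe p q x"
    "delivered A vin (d1 @ h1)"
    using deliver_all[OF h1(3)] .
  define h2 where "h2 = d1 @ h1"
  have h2: "acts h2 = acts h1" "ph h2 p = ph h1 p" "ok h2" for p
    using d1 by (simp_all add: h2_def hist_acts_append_observes ph_append_observes)
  have log2: "choice c \<in> set (log h2 p)" if "p < n" for p
    using delivered_log[OF d1(3) _ that] h2 h1 by (simp add: h2_def)
  \<comment> \<open>First steps of all voters and remaining helpers; all of them have heard
    \<open>c\<close>, and helper \<open>m + c\<close> merely idles.\<close>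
  define h3 where "h3 = map Step [1..<n] @ h2"
  have step3: "pstep m w a (p, ph h2 p, log h2 p) =
      ((p, Waiting, log h2 p), if p = m + c then Skip else Communicate (present p))"
    if "p \<in> {1..<n}" for p
    using that log2[of p] by (auto simp: h2 h1)
  have ph3: "ph h3 p = (if p = 0 then Done else Waiting)" if "p < n" for p
    using that step3[of p] h1 h2 by (auto simp: h3_def step_each)
  have acts3: "acts h3 = (\<lambda>p. (p, if p = m + c then Skip else Communicate (present p))) ` {1..<n}
      \<union> acts h1"
    unfolding h3_def using step3 by (auto simp: step_each h2(1) image_iff)
  have ok3: "ok h3" using h2 by (auto simp: h3_def step_each)
  obtain d2 where d2: "ok (d2 @ h3)" "\<forall>e \<in> set d2. \<exists>p q x. e = Observe p q x"
    "delivered A vin (d2 @ h3)"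
    using deliver_all[OF ok3] .
  define h4 where "h4 = d2 @ h3"
  have h4: "acts h4 = acts h3" "ph h4 p = ph h3 p" "ok h4" "delivered A vin h4" for p
    using d2 by (simp_all add: h4_def hist_acts_append_observes ph_append_observes)
  have c4: "(0, Communicate (choice c)) \<in> acts h4" using h4 acts3 h1 by simp
  have present4: "present j \<in> set (log h4 p)" if "p < n" "j \<in> {1..<m}" for p j
  proof -
    have "(j, Communicate (present j)) \<in> acts h4" using that(2) m by (force simp: h4 acts3)
    then show ?thesis using delivered_log[OF h4(4)] that(1) by blast
  qed
  have choice4: "(SOME d. choice d \<in> set (log h4 p)) = c" if "p < n" for p
  proof (rule some_equality)
    show "choice c \<in> set (log h4 p)" using delivered_log[OF h4(4) c4 that] .
    fix d assume "choice d \<in> set (log h4 p)"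
    then show "d = c" using choice_unique[OF c4] log_choice[OF h4(3)] by metis
  qed
  \<comment> \<open>Second round: every voter votes for \<open>c\<close> and the helpers idle.
    Outputs create nothing to deliver, so \<open>h5\<close> is quiescent.\<close>
  define h5 where "h5 = map Step [1..<n] @ h4"
  have step5: "pstep m w a (p, ph h4 p, log h4 p) =
      (if p < m then ((p, Done, log h4 p), Output (w c p)) else ((p, Waiting, log h4 p), Skip))"
    if "p \<in> {1..<n}" for p
  proof -
    have "\<forall>j \<in> {1..<m}. present j \<in> set (log h4 p)" using that present4[of p] by simp
    then show ?thesis using that choice4[of p] by (simp add: h4 ph3)
  qed
  have ph5: "ph h5 p = (if p < m then Done else Waiting)" if "p < n" for p
  proof (cases "p = 0")
    case True
    then show ?thesis using that m by (simp add: h5_def step_each h4 ph3)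
  next
    case False
    then have "p \<in> {1..<n}" using that by simp
    then show ?thesis by (simp only: h5_def step_each distinct_upt set_upt step5) simp
  qed
  have acts5: "acts h5 = (\<lambda>p. (p, if p < m then Output (w c p) else Skip)) ` {1..<n} \<union> acts h4"
    unfolding h5_def using step5 by (auto simp: step_each image_iff)
  have "ok h5" using h4 by (auto simp: h5_def step_each)
  moreover have "Crash p \<notin> set h5" for p
    using d1(2) d2(2) by (auto simp: h5_def h4_def h3_def h2_def h1_def)
  moreover have "delivered A vin h5"
  proof -
    have "(q, Communicate x) \<in> acts h5 \<longleftrightarrow> (q, Communicate x) \<in> acts h4" for q x
      by (auto simp: acts5 split: if_splits)
    moreover have "set h4 \<subseteq> set h5" by (auto simp: h5_def)
    ultimately show ?thesis using h4(4) by (auto simp: delivered_def)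
  qed
  moreover have "local_step A (hist_states A vin h5 p) = (hist_states A vin h5 p, Skip)"
    if "p < length vin" for p
    using that ph5[of p] by (simp add: local_step_eq) (simp add: hist_states_eq)
  moreover have "vin \<noteq> []" using m by simp
  ultimately obtain \<sigma> where \<sigma>: "execution f A vin \<sigma>"
    "\<And>p a. a \<noteq> Skip \<Longrightarrow> (\<exists>t. performs A vin \<sigma> t p a) \<longleftrightarrow> (p, a) \<in> acts h5"
    using quiescent_execution[of A vin h5 f] by (metis admitted_eq insertI1)
  have "(p, Output v) \<in> acts h5 \<longleftrightarrow> p < m \<and> v = w c p" for p v
    using m by (cases "p = 0") (auto simp: acts5 h4 acts3 h1 image_iff)
  then have "{v. \<exists>p t. performs A vin \<sigma> t p (Output v)} = w c ` {..<m}"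
    using \<sigma>(2) by auto
  then show thesis using that[OF \<sigma>(1)] output_set_eq[OF \<sigma>(1)] by simp
qed

end

section \<open>Choice of the parameters and the resulting task\<close>

lemma ex_enumeration:
  assumes "finite S" "S \<noteq> {}" "card S \<le> m"
  obtains g :: "nat \<Rightarrow> 'v" where "g ` {..<m} = S"
proof -
  obtain e where e: "bij_betw e {0..<card S} S" using ex_bij_betw_nat_finite[OF assms(1)] ..
  \<comment> \<open>Indices from \<open>card S\<close> on repeat \<open>e 0\<close>, which lies in
    \<open>S\<close> because \<open>S\<close> is nonempty.\<close>
  define g where "g i = e (if i < card S then i else 0)" for i
  have pos: "0 < card S" using assms by (simp add: card_gt_0_iff)
  have img: "e ` {0..<card S} = S" using e by (rule bij_betw_imp_surj_on)
  have "g ` {..<m} = e ` {0..<card S}"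
  proof (intro equalityI subsetI)
    fix x assume "x \<in> e ` {0..<card S}"
    then obtain i where "i < card S" "x = e i" by auto
    then show "x \<in> g ` {..<m}" using assms(3) by (intro image_eqI[of _ _ i]) (auto simp: g_def)
  qed (use pos in \<open>auto simp: g_def\<close>)
  then show thesis using that img by simp
qed

theorem corollary1:
  fixes k f :: nat and V :: "'v set"
  assumes "k \<ge> 2" and "finite V" and "card V \<ge> k + 1"
  shows "async_solvable f (SOS_problem V {S. S \<subseteq> V \<and> 1 \<le> card S \<and> card S \<le> k})"
proof -
  define Os where "Os = {S. S \<subseteq> V \<and> 1 \<le> card S \<and> card S \<le> k}"
  \<comment> \<open>\<open>m > f\<close> leaves a correct process among leader and voters, and
    \<open>m \<ge> k\<close> lets \<open>m\<close> entries list any admissible set.\<close>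
  define m where "m = f + k"
  have fin: "finite S" if "S \<subseteq> V" for S using that assms(2) finite_subset by blast
  have Os_nonempty: "S \<noteq> {}" if "S \<in> Os" for S using that by (auto simp: Os_def)
  have OsI: "S \<in> Os" if "S \<subseteq> B" "S \<noteq> {}" "B \<subseteq> V" "card B \<le> k" for S B
  proof -
    have "card S \<le> card B" using that fin by (intro card_mono) auto
    moreover have "1 \<le> card S" using that fin[of S] by (simp add: Suc_le_eq card_gt_0_iff)
    ultimately show ?thesis using that by (auto simp: Os_def)
  qed
  obtain a where a: "a \<in> V" using assms(3) by fastforce
  have "{a} \<in> Os" using a assms(1) by (simp add: Os_def)
  have "finite Os" using assms(2) by (simp add: Os_def)
  then obtain Ss where Ss: "set Ss = Os" using finite_list by blast
  define N where "N = length Ss"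
  have N: "0 < N" using Ss \<open>{a} \<in> Os\<close> by (auto simp: N_def)
  have "\<exists>g :: nat \<Rightarrow> 'v. g ` {..<m} = S" if "S \<in> Os" for S
  proof -
    have "finite S" "card S \<le> m" using that fin by (auto simp: Os_def m_def)
    then show ?thesis using ex_enumeration Os_nonempty[OF that] by metis
  qed
  then obtain g where g: "\<And>S. S \<in> Os \<Longrightarrow> g S ` {..<m} = S" by metis
  \<comment> \<open>Reduction modulo \<open>N\<close> makes every natural number an admissible
    choice, as the leader's \<open>SOME\<close> may return any.\<close>
  define w where "w c = g (Ss ! (c mod N))" for c
  have w: "w c ` {..<m} \<in> Os" for c
  proof -
    have "Ss ! (c mod N) \<in> Os" using N Ss by (metis N_def mod_less_divisor nth_mem)
    then show ?thesis using g by (simp add: w_def)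
  qed
  have w_surj: "\<exists>c < N. w c ` {..<m} = S" if "S \<in> Os" for S
  proof -
    obtain c where "c < N" "Ss ! c = S" using \<open>S \<in> Os\<close> Ss by (metis N_def in_set_conv_nth)
    then show ?thesis using g[OF \<open>S \<in> Os\<close>] by (intro exI[of _ c]) (simp add: w_def)
  qed
  have m_bounds: "0 < m" "f < m" using assms(1) by (auto simp: m_def)
  \<comment> \<open>One helper for each admissible output set.\<close>
  define n where "n = m + N"
  interpret word_algorithm n m w a
    using m_bounds by unfold_locales (auto simp: n_def)
  have safe: "output_set (output_vector A vin \<sigma>) \<in> Os" if ex: "execution f A vin \<sigma>" for \<sigma>
  proof -
    let ?S = "output_set (output_vector A vin \<sigma>)"
    obtain c where "?S \<subseteq> w c ` {..<m} \<or> ?S \<subseteq> {a, w c 0}"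
      using execution_outputs(2)[OF ex m_bounds(2)] by blast
    moreover have "w c ` {..<m} \<subseteq> V" "card (w c ` {..<m}) \<le> k" using w[of c] by (auto simp: Os_def)
    moreover from this have "{a, w c 0} \<subseteq> V" using a m by auto
    \<comment> \<open>Here \<open>k \<ge> 2\<close> enters: the default and the leader's entry may
      differ.\<close>
    moreover have "card {a, w c 0} \<le> k"
      using assms(1) card_insert_le_m1[of 2 "{w c 0}" a] by auto
    ultimately show ?thesis using OsI execution_outputs(1)[OF ex m_bounds(2)] by blast
  qed
  have complete: "\<exists>\<sigma>. execution f A vin \<sigma> \<and> output_set (output_vector A vin \<sigma>) = S"
    if "S \<in> Os" for S
    using w_surj[OF that] execution_exists[where f = f] by (metis n_def nat_add_left_cancel_less)
  have len: "length (output_vector A vin \<sigma>) = n" for \<sigma> by (simp add: output_vector_def)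
  define T where "T = algorithm_task f A"
  have ex_vin: "xs = vin" if "execution f A xs \<sigma>" for xs \<sigma>
    using that by (simp add: execution_def)
  define outs where "outs = {output_vector A vin \<sigma> | \<sigma>. execution f A vin \<sigma>}"
  have T: "task_in T = {vin}" "task_out T = outs" "task_rel T = {vin} \<times> outs"
    by (auto simp: T_def algorithm_task_def outs_def dest: ex_vin)
  have len_outs: "length y = n" if "y \<in> outs" for y using that len by (auto simp: outs_def)
  have "outs \<subseteq> vectors V"
  proof
    fix y assume y: "y \<in> outs"
    then have "output_set y \<subseteq> V" using safe by (auto simp: outs_def Os_def)
    have "z \<in> insert None (Some ` V)" if "z \<in> set y" for z
    proof (cases z)
      case (Some v)
      then have "v \<in> output_set y" using that by (simp add: output_set_def)
      then show ?thesis using \<open>output_set y \<subseteq> V\<close> Some by blast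
    qed simp
    moreover have "y \<noteq> []" using len_outs[OF y] m_bounds by (auto simp: n_def)
    ultimately show "y \<in> vectors V" unfolding vectors_def by blast
  qed
  moreover have "outs \<noteq> {}"
  proof -
    obtain \<sigma> where "execution f A vin \<sigma>" using complete[OF \<open>{a} \<in> Os\<close>] by blast
    then show ?thesis unfolding outs_def by blast
  qed
  moreover have "vin \<in> vectors V" using m_bounds by (simp add: vectors_def n_def)
  ultimately have "is_task V T" using len_outs by (auto simp: is_task_def T)
  moreover have "SOS (restrict_task j T) = Os \<and>
      task_rel (restrict_task j T) = task_in (restrict_task j T) \<times> task_out (restrict_task j T)"
    if "task_rel (restrict_task j T) \<noteq> {}" for j
  proof -
    \<comment> \<open>All vectors of \<open>T\<close> have size \<open>n\<close>, so no other
      restriction is nonempty.\<close>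
    have "j = n" using that by (auto simp: restrict_task_def T)
    have r: "restrict_task n T = T"
    proof (rule task.equality)
      show "task_in (restrict_task n T) = task_in T" "task_out (restrict_task n T) = task_out T"
        "task_rel (restrict_task n T) = task_rel T"
        using len_outs by (auto simp: restrict_task_def T)
    qed simp
    have "SOS T = output_set ` outs" by (auto simp: SOS_def T)
    also have "\<dots> = Os"
    proof (intro equalityI subsetI)
      fix S assume "S \<in> Os"
      then obtain \<sigma> where "execution f A vin \<sigma>" "output_set (output_vector A vin \<sigma>) = S"
        using complete by blast
      then show "S \<in> output_set ` outs" unfolding outs_def by blast
    next
      fix S assume "S \<in> output_set ` outs"
      then show "S \<in> Os" unfolding outs_def using safe by blast
    qed
    finally show ?thesis using \<open>j = n\<close> r T by simp
  qed
  ultimately have "T \<in> SOS_problem V Os" by (simp add: SOS_problem_def)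
  moreover have "implements f A T"
    using valid[of f] m_bounds by (simp add: implements_def T_def n_def)
  ultimately show ?thesis unfolding async_solvable_def Os_def by blast
qed

end
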